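(* Assume (A1)–(A4) (stated in the context). Let $p\in(0,1)$ and $L\in\mathbb N$. Define the level-wise updates $\Delta g_l:=g_l-g_{l-1}$ with the convention $g_0:=0$, put for $l=1,\dots,L$ $$\gamma_l:=2^{-\alpha(L-l)},\qquad p_l:=\tfrac p2\,2^{-(L-l)},\qquad n_l:=n_{p_l,\gamma_l}=n_0\,2^{\alpha\beta(L-l)}\log(p_l^{-1}),$$ and define the multi-level approximation $$\tilde g_L^{\mathrm{ML}}:=\sum_{l=1}^L\Delta\tilde g_l^{\mathrm{ML}},\qquad \Delta\tilde g_l^{\mathrm{ML}}:=P^{n_l}_{\mathcal M_{\gamma_l}}\Delta g_l .$$ Let $\tau_L^{\mathrm{ML}}$ be the work required to compute $\tilde g_L^{\mathrm{ML}}$ (counted as $\sum_{l=1}^L n_l\tau_l$) and let $\omega_L^{\mathrm{ML}}:=\tau_L^{\mathrm{ML}}/\tau_L$ be the work overhead. Then the multi-level approximation satisfies the error bound $$\|g-\tilde g_L^{\mathrm{ML}}\|_{L^2(\mu)}\lesssim 2^{-\alpha L}L$$ with probability $1-p$ and a work overhead bounded by $$\omega_L^{\mathrm{ML}}\lesssim\log(p^{-1}).$$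
   Context: Notation. $\lesssim$ and $\asymp$ denote inequality and two-sided equivalence up to positive multiplicative constants that do not depend on the level ($L$ or $l$). PDE setting. $D\subset\mathbb R^d$ is a bounded Lipschitz domain, $M\in\mathbb N$, $M>0$, $U=[-1,1]^M$, and $a(x,\boldsymbol y)=a_0(x)+\sum_{m=1}^M \boldsymbol y_m a_m(x)$ is uniformly elliptic, i.e. $0<r\le a(x,\boldsymbol y)\le R<\infty$ on $D\times U$. Let $V=H^1_0(D)$, $f\in V^*$, $G\in V^*$. For $\boldsymbol y\in U$, $u(\boldsymbol y)\in V$ is the solution of $\int_D a(x,\boldsymbol y)\nabla u(\boldsymbol y)\cdot\nabla v\,\mathrm dx=\langle f,v\rangle_{V^*,V}$ for all $v\in V$. $V_0\subset V_1\subset\cdots\subset V$ are nested finite-dimensional subspaces whose union is dense in $V$, and $u_l(\boldsymbol y)\in V_l$ is the Galerkin solution (same equation, test functions $v\in V_l$). Quantities of interest: $g(\boldsymbol y):=G(u(\boldsymbol y))$, $g_l(\boldsymbol y):=G(u_l(\boldsymbol y))$ (in the definition of the level-wise updates, $g_0$ is replaced by $0$). Approximation setting. $\mu$ is a probability measure on $U$. $\mathcal S\subseteq L^\infty(\mu)$ is a quasi-normed space with $g\in\mathcal S$ and $g_l\in\mathcal S$ for all $l\in\mathbb N$. $\{\mathcal M_\gamma\}_{\gamma>0}$ is a family of model classes (sets of functions on $U$). $w\ge0$ is any weight function with $\int w^{-1}\,\mathrm d\mu=1$. For $n\in\mathbb N$ and i.i.d. sample points $\boldsymbol y_1,\dots,\boldsymbol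 y_n\sim w^{-1}\mu$ set $\|v\|_n:=\big(\frac1n\sum_{i=1}^n w(\boldsymbol y_i)|v(\boldsymbol y_i)|^2\big)^{1/2}$, and let $P^n_{\mathcal M_\gamma}z\in\arg\min_{v\in\mathcal M_\gamma}\|z-v\|_n$ denote the (random) weighted least squares approximation of $z$. Assumptions. (A1) There exist constants $A,\alpha>0$ such that $\|g-g_l\|_{\mathcal S}\le A2^{-\alpha l}$ for all $l\in\mathbb N$. (A2) There exists $C>0$ such that $\inf_{v\in\mathcal M_\gamma}\|z-v\|_{L^\infty(\mu)}\le C\gamma\|z\|_{\mathcal S}$ for all $\gamma>0$ and $z\in\mathcal S$. (A3) There exist $B,\beta>0$ such that for all $p\in(0,1)$ and $\gamma>0$ there exist $n_0,n_{p,\gamma}\in\mathbb N$ with $n_{p,\gamma}\le n_0\gamma^{-\beta}\log(p^{-1})$ and $\|z-P^{n_{p,\gamma}}_{\mathcal M_\gamma}z\|_{L^2(\mu)}\le B\inf_{v\in\mathcal M_\gamma}\|z-v\|_{L^\infty(\mu)}$ with probability $1-p$ for every $z\in L^\infty(\mu)\subseteq L^2(\mu)$. (A4) There exists $\delta>\alpha\beta$ such that the computation time $\tau_l$ of $g_l(\boldsymbol y)$ is independent of $\boldsymbol y$ and satisfies $\tau_l\asymp2^{\delta l}$ for all $\boldsymbol y\in U$.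
   Formalization: The inclusion of S in L^∞(μ) is assumed continuous; in (A3) n_0 does not depend on p or γ, and n_{p,γ} ≥ 1 is bounded by the rounded-up value of n_0 γ^{-β} log(1/p); the work-overhead constant is uniform in L and in p ≤ q for each q < 1. *)

theory Defs
  imports "HOL-Probability.Probability"
begin

definition Linf_norm :: "'a measure \<Rightarrow> ('a \<Rightarrow> real) \<Rightarrow> ennreal" where
  "Linf_norm M z = esssup M (\<lambda>x. ennreal \<bar>z x\<bar>)"

definition Linf :: "'a measure \<Rightarrow> ('a \<Rightarrow> real) set" where
  "Linf M = {z \<in> borel_measurable M. Linf_norm M z < \<infinity>}"

definition L2 :: "'a measure \<Rightarrow> ('a \<Rightarrow> 'b::{banach, second_countable_topology}) set" where
  "L2 M = {z \<in> borel_measurable M. integrable M (\<lambda>x. (norm (z x))\<^sup>2)}"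

text \<open>The value is infinite outside of \<^term>\<open>L2 M\<close>, so that an upper bound on the norm
  includes membership in the space.\<close>

definition L2_norm :: "'a measure \<Rightarrow> ('a \<Rightarrow> real) \<Rightarrow> ennreal" where
  "L2_norm M z =
    (if z \<in> L2 M then ennreal (sqrt (LINT x|M. (z x)\<^sup>2)) else \<infinity>)"

text \<open>``With probability (at least) \<open>q\<close>''. The set of all outcomes satisfying \<open>Q\<close> need not be
  measurable, because a least squares minimiser may be selected in a non-measurable way; it is
  required to contain a measurable event of probability at least \<open>q\<close>. For a measurable set of
  outcomes this is the usual notion.\<close>

definition with_probability :: "'a measure \<Rightarrow> real \<Rightarrow> ('a \<Rightarrow> bool) \<Rightarrow> bool" where
  "with_probability M q Q \<longleftrightarrow> (\<exists>E\<in>sets M. q \<le> measure M E \<and> (\<forall>\<omega>\<in>E. Q \<omega>))"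

text \<open>A quasi-normed space contained in \<open>L\<^sup>\<infinity>\<close>. Classes of almost everywhere equal functions are
  represented by the set of all their measurable representatives.\<close>

definition quasi_normed_subspace ::
  "'a measure \<Rightarrow> ('a \<Rightarrow> real) set \<Rightarrow> (('a \<Rightarrow> real) \<Rightarrow> real) \<Rightarrow> bool" where
  "quasi_normed_subspace M S N \<longleftrightarrow>
     S \<subseteq> Linf M \<and>
     (\<lambda>x. 0) \<in> S \<and>
     (\<forall>u\<in>S. \<forall>v\<in>S. (\<lambda>x. u x + v x) \<in> S) \<and>
     (\<forall>c. \<forall>u\<in>S. (\<lambda>x. c * u x) \<in> S) \<and>
     (\<forall>u\<in>S. \<forall>v\<in>borel_measurable M. (AE x in M. u x = v x) \<longrightarrow> v \<in> S \<and> N v = N u) \<and>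
     (\<forall>u\<in>S. 0 \<le> N u \<and> (N u = 0 \<longleftrightarrow> (AE x in M. u x = 0))) \<and>
     (\<forall>c. \<forall>u\<in>S. N (\<lambda>x. c * u x) = \<bar>c\<bar> * N u) \<and>
     (\<exists>K\<ge>1. \<forall>u\<in>S. \<forall>v\<in>S. N (\<lambda>x. u x + v x) \<le> K * (N u + N v))"

definition continuously_embedded ::
  "'a measure \<Rightarrow> ('a \<Rightarrow> real) set \<Rightarrow> (('a \<Rightarrow> real) \<Rightarrow> real) \<Rightarrow> bool" where
  "continuously_embedded M S N \<longleftrightarrow> (\<exists>K. \<forall>z\<in>S. Linf_norm M z \<le> ennreal (K * N z))"

text \<open>A bounded domain that near each boundary point \<open>x0\<close> is the part of a ball lying above
  the graph of a Lipschitz function \<open>\<eta>\<close>, in an orthonormal coordinate system whose last axis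
  is \<open>e\<close>. The function \<open>\<eta>\<close> lives on the orthogonal complement of \<open>e\<close>.\<close>

definition bounded_Lipschitz_domain :: "(real ^ 'd) set \<Rightarrow> bool" where
  "bounded_Lipschitz_domain D \<longleftrightarrow>
     D \<noteq> {} \<and> open D \<and> connected D \<and> bounded D \<and>
     (\<forall>x0\<in>frontier D. \<exists>\<rho>>0. \<exists>e. \<exists>K. \<exists>\<eta>. norm e = 1 \<and> K-lipschitz_on {z. z \<bullet> e = 0} \<eta> \<and>
        D \<inter> ball x0 \<rho> = {x \<in> ball x0 \<rho>. \<eta> (x - (x \<bullet> e) *\<^sub>R e) < x \<bullet> e})"

primrec Ck :: "nat \<Rightarrow> (real ^ 'd \<Rightarrow> real) \<Rightarrow> bool" where
  "Ck 0 \<phi> \<longleftrightarrow> continuous_on UNIV \<phi>"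
| "Ck (Suc k) \<phi> \<longleftrightarrow>
     (\<exists>\<psi>. (\<forall>x. GDERIV \<phi> x :> \<psi> x) \<and> (\<forall>i. Ck k (\<lambda>x. \<psi> x $ i)))"

definition test_functions :: "(real ^ 'd) set \<Rightarrow> (real ^ 'd \<Rightarrow> real) set" where
  "test_functions D =
     {\<phi>. (\<forall>k. Ck k \<phi>) \<and> compact (closure {x. \<phi> x \<noteq> 0}) \<and> closure {x. \<phi> x \<noteq> 0} \<subseteq> D}"

definition weak_gradient ::
  "(real ^ 'd) set \<Rightarrow> (real ^ 'd \<Rightarrow> real) \<Rightarrow> (real ^ 'd \<Rightarrow> real ^ 'd) \<Rightarrow> bool" where
  "weak_gradient D v q \<longleftrightarrow>
     (\<forall>\<phi>\<in>test_functions D. \<forall>\<psi>. (\<forall>x. GDERIV \<phi> x :> \<psi> x) \<longrightarrow>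
        (LINT x|lebesgue_on D. v x *\<^sub>R \<psi> x) = - (LINT x|lebesgue_on D. \<phi> x *\<^sub>R q x))"

definition H1 :: "(real ^ 'd) set \<Rightarrow> (real ^ 'd \<Rightarrow> real) set" where
  "H1 D = {v \<in> L2 (lebesgue_on D). \<exists>q \<in> L2 (lebesgue_on D). weak_gradient D v q}"

text \<open>A representative of the weak gradient, which is unique up to null sets.\<close>

definition wgrad :: "(real ^ 'd) set \<Rightarrow> (real ^ 'd \<Rightarrow> real) \<Rightarrow> real ^ 'd \<Rightarrow> real ^ 'd" where
  "wgrad D v = (SOME q. q \<in> L2 (lebesgue_on D) \<and> weak_gradient D v q)"

definition H1_norm :: "(real ^ 'd) set \<Rightarrow> (real ^ 'd \<Rightarrow> real) \<Rightarrow> real" where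
  "H1_norm D v =
     sqrt ((LINT x|lebesgue_on D. (v x)\<^sup>2) + (LINT x|lebesgue_on D. (norm (wgrad D v x))\<^sup>2))"

definition H10 :: "(real ^ 'd) set \<Rightarrow> (real ^ 'd \<Rightarrow> real) set" where
  "H10 D = {v \<in> H1 D. \<forall>\<epsilon>>0. \<exists>\<phi>\<in>test_functions D. H1_norm D (\<lambda>x. v x - \<phi> x) < \<epsilon>}"

definition dual_H10 :: "(real ^ 'd) set \<Rightarrow> ((real ^ 'd \<Rightarrow> real) \<Rightarrow> real) set" where
  "dual_H10 D = {F.
     (\<forall>u\<in>H10 D. \<forall>v\<in>H10 D. F (\<lambda>x. u x + v x) = F u + F v) \<and>
     (\<forall>c. \<forall>u\<in>H10 D. F (\<lambda>x. c * u x) = c * F u) \<and>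
     (\<exists>K. \<forall>u\<in>H10 D. \<bar>F u\<bar> \<le> K * H1_norm D u)}"

definition finite_dim_subspace ::
  "(real ^ 'd) set \<Rightarrow> (real ^ 'd \<Rightarrow> real) set \<Rightarrow> bool" where
  "finite_dim_subspace D W \<longleftrightarrow>
     (\<exists>k::nat. \<exists>b. (\<forall>i<k. b i \<in> H10 D) \<and> W = {\<lambda>x. \<Sum>i<k. c i * b i x | c. True})"

definition galerkin_spaces ::
  "(real ^ 'd) set \<Rightarrow> (nat \<Rightarrow> (real ^ 'd \<Rightarrow> real) set) \<Rightarrow> bool" where
  "galerkin_spaces D V \<longleftrightarrow>
     (\<forall>l. finite_dim_subspace D (V l)) \<and>
     (\<forall>l. V l \<subseteq> V (Suc l)) \<and>
     (\<forall>v\<in>H10 D. \<forall>\<epsilon>>0. \<exists>l. \<exists>w\<in>V l. H1_norm D (\<lambda>x. v x - w x) < \<epsilon>)"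

definition param_box :: "(real ^ 'm) set" where
  "param_box = {y. \<forall>m. -1 \<le> y $ m \<and> y $ m \<le> 1}"

definition affine_coeff ::
  "('x \<Rightarrow> real) \<Rightarrow> ('m \<Rightarrow> 'x \<Rightarrow> real) \<Rightarrow> 'x \<Rightarrow> real ^ 'm \<Rightarrow> real" where
  "affine_coeff a\<^sub>0 a x y = a\<^sub>0 x + (\<Sum>m\<in>UNIV. y $ m * a m x)"

text \<open>The solution in the trial and test space \<open>W\<close>: \<^term>\<open>H10 D\<close> for the exact problem, a
  finite-dimensional subspace for the Galerkin problem.\<close>

definition variational_solution ::
  "(real ^ 'd) set \<Rightarrow> (real ^ 'd \<Rightarrow> real) set \<Rightarrow> (real ^ 'd \<Rightarrow> real) \<Rightarrow>
   ((real ^ 'd \<Rightarrow> real) \<Rightarrow> real) \<Rightarrow> (real ^ 'd \<Rightarrow> real) \<Rightarrow> bool" where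
  "variational_solution D W \<kappa> f u \<longleftrightarrow>
     u \<in> W \<and> (\<forall>v\<in>W. (LINT x|lebesgue_on D. \<kappa> x * (wgrad D u x \<bullet> wgrad D v x)) = f v)"

text \<open>The reciprocal is taken in \<^typ>\<open>ennreal\<close>, where \<open>inverse 0 = \<infinity>\<close>; total mass one thus
  excludes a weight vanishing on a set of positive measure.\<close>

definition sampling_measure :: "'y measure \<Rightarrow> ('y \<Rightarrow> real) \<Rightarrow> 'y measure" where
  "sampling_measure \<mu> w = density \<mu> (\<lambda>y. inverse (ennreal (w y)))"

definition empirical_norm :: "('y \<Rightarrow> real) \<Rightarrow> nat \<Rightarrow> (nat \<Rightarrow> 'y) \<Rightarrow> ('y \<Rightarrow> real) \<Rightarrow> real" where
  "empirical_norm w n ys v = sqrt (1 / real n * (\<Sum>i<n. w (ys i) * \<bar>v (ys i)\<bar>\<^sup>2))"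

text \<open>\<open>P \<gamma> n ys z\<close> is a minimiser over the model class for the sample points
  \<open>ys 0, \<dots>, ys (n - 1)\<close>; the choice among several minimisers is arbitrary.\<close>

definition least_squares_approximation ::
  "'y measure \<Rightarrow> ('y \<Rightarrow> real) \<Rightarrow> (real \<Rightarrow> ('y \<Rightarrow> real) set) \<Rightarrow>
   (real \<Rightarrow> nat \<Rightarrow> (nat \<Rightarrow> 'y) \<Rightarrow> ('y \<Rightarrow> real) \<Rightarrow> ('y \<Rightarrow> real)) \<Rightarrow> bool" where
  "least_squares_approximation \<mu> w \<M> P \<longleftrightarrow>
     (\<forall>\<gamma>>0. \<forall>n\<ge>1. \<forall>ys \<in> {..<n} \<rightarrow>\<^sub>E space \<mu>. \<forall>z\<in>Linf \<mu>.
        is_arg_min (\<lambda>v. empirical_norm w n ys (\<lambda>y. z y - v y)) (\<lambda>v. v \<in> \<M> \<gamma>) (P \<gamma> n ys z))"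

definition iid_samples ::
  "'w measure \<Rightarrow> 'y measure \<Rightarrow> nat \<Rightarrow> (nat \<Rightarrow> 'w \<Rightarrow> 'y) \<Rightarrow> bool" where
  "iid_samples \<Omega> \<nu> n Y \<longleftrightarrow>
     prob_space.indep_vars \<Omega> (\<lambda>_. \<nu>) Y {..<n} \<and> (\<forall>i<n. distr \<Omega> \<nu> (Y i) = \<nu>)"

definition level_update :: "(nat \<Rightarrow> 'y \<Rightarrow> real) \<Rightarrow> nat \<Rightarrow> 'y \<Rightarrow> real" where
  "level_update gl l y = gl l y - (if l = 1 then 0 else gl (l - 1) y)"

definition level_\<gamma> :: "real \<Rightarrow> nat \<Rightarrow> nat \<Rightarrow> real" where
  "level_\<gamma> \<alpha> L l = 2 powr (- \<alpha> * (real L - real l))"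

definition level_p :: "real \<Rightarrow> nat \<Rightarrow> nat \<Rightarrow> real" where
  "level_p p L l = p / 2 * 2 powr (- (real L - real l))"

definition level_n :: "(real \<Rightarrow> real \<Rightarrow> nat) \<Rightarrow> real \<Rightarrow> real \<Rightarrow> nat \<Rightarrow> nat \<Rightarrow> nat" where
  "level_n n \<alpha> p L l = n (level_p p L l) (level_\<gamma> \<alpha> L l)"

text \<open>\<open>ys l i\<close> is the \<open>i\<close>-th sample point used on level \<open>l\<close>.\<close>

definition multilevel_approximation ::
  "(real \<Rightarrow> nat \<Rightarrow> (nat \<Rightarrow> 'y) \<Rightarrow> ('y \<Rightarrow> real) \<Rightarrow> ('y \<Rightarrow> real)) \<Rightarrow> (real \<Rightarrow> real \<Rightarrow> nat) \<Rightarrow>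
   real \<Rightarrow> (nat \<Rightarrow> 'y \<Rightarrow> real) \<Rightarrow> real \<Rightarrow> nat \<Rightarrow> (nat \<Rightarrow> nat \<Rightarrow> 'y) \<Rightarrow> 'y \<Rightarrow> real" where
  "multilevel_approximation P n \<alpha> gl p L ys y =
     (\<Sum>l=1..L. P (level_\<gamma> \<alpha> L l) (level_n n \<alpha> p L l)
        (restrict (ys l) {..<level_n n \<alpha> p L l}) (level_update gl l) y)"

definition multilevel_work ::
  "(real \<Rightarrow> real \<Rightarrow> nat) \<Rightarrow> real \<Rightarrow> (nat \<Rightarrow> real) \<Rightarrow> real \<Rightarrow> nat \<Rightarrow> real" where
  "multilevel_work n \<alpha> \<tau> p L = (\<Sum>l=1..L. real (level_n n \<alpha> p L l) * \<tau> l)"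

definition work_overhead ::
  "(real \<Rightarrow> real \<Rightarrow> nat) \<Rightarrow> real \<Rightarrow> (nat \<Rightarrow> real) \<Rightarrow> real \<Rightarrow> nat \<Rightarrow> real" where
  "work_overhead n \<alpha> \<tau> p L = multilevel_work n \<alpha> \<tau> p L / \<tau> L"

end

theory Submission
  imports Defs
begin

text \<open>
  The error splits into a discretisation error and one projection error per level, because the
  level updates telescope to \<open>gl L\<close>. Each of these \<open>L + 1\<close> pieces is at most of order \<open>2 powr (- \<alpha> * L)\<close>:
  an update \<open>gl l - gl (l - 1)\<close> has quasi-norm of order \<open>2 powr (- \<alpha> * l)\<close>, since \<open>g\<close> is close to both
  terms (\<open>quasi_norm_level_update_le\<close>), and the tolerance \<open>level_\<gamma> \<alpha> L l\<close> supplies exactly the missing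
  factor \<open>2 powr (- \<alpha> * (L - l))\<close>. The triangle inequality in \<open>L\<^sup>2\<close> (\<open>L2_norm_add_le\<close>) then costs the
  factor \<open>L\<close>. The quasi-norm is used for two terms at a time only, so its constant does not
  accumulate.

  The projection on level \<open>l\<close> fails with probability at most \<open>level_p p L l\<close>. These numbers form a
  geometric sequence with sum at most \<open>p\<close>, so a union bound makes all levels succeed together with
  probability \<open>1 - p\<close> (\<open>with_probability_union_bound\<close>). Within one level, the joint law of the sample
  points is the product measure, to which the guarantee for a single projection refers
  (\<open>with_probability_iid_samples\<close>).

  For the work, put \<open>k = L - l\<close>. Up to constants, level \<open>l\<close> needs at most
  \<open>2 powr (\<alpha> * \<beta> * k) * (ln (1 / p) + 1 + k)\<close> samples, and each costs \<open>2 powr (- \<delta> * k)\<close> times as much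
  as a sample on level \<open>L\<close>. Since \<open>\<alpha> * \<beta> < \<delta>\<close>, the sum over
  \<open>k\<close> is dominated by a convergent series that does not depend on \<open>L\<close> (\<open>work_overhead_le\<close>).
\<close>

section \<open>The norm of square integrable functions\<close>

lemma L2_norm_eq_ennreal:
  "z \<in> L2 M \<Longrightarrow> L2_norm M z = ennreal (sqrt (LINT x|M. (z x)\<^sup>2))"
  by (simp add: L2_norm_def)

text \<open>Convexity of the square. Integrating it with \<open>a\<close> and \<open>b\<close> close to the norms of the two
  functions gives the triangle inequality, without a detour through the Cauchy-Schwarz inequality;
  with \<open>a = b = 1\<close> it gives the closure of \<open>L\<^sup>2\<close> under addition.\<close>

lemma square_add_le_weighted:
  fixes x y a b :: real
  assumes "0 < a" "0 < b"
  shows "(x + y)\<^sup>2 \<le> (a + b) * (x\<^sup>2 / a + y\<^sup>2 / b)"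
proof -
  have "(a + b) * (x\<^sup>2 / a + y\<^sup>2 / b) - (x + y)\<^sup>2 = (b * x - a * y)\<^sup>2 / (a * b)"
    using assms by (simp add: field_simps power2_eq_square)
  moreover have "0 \<le> (b * x - a * y)\<^sup>2 / (a * b)"
    using assms by simp
  ultimately show ?thesis by linarith
qed

lemma L2_add:
  fixes f h :: "'a \<Rightarrow> real"
  assumes "f \<in> L2 M" "h \<in> L2 M"
  shows "(\<lambda>x. f x + h x) \<in> L2 M"
proof -
  have [measurable]: "f \<in> borel_measurable M" "h \<in> borel_measurable M"
    using assms by (auto simp: L2_def)
  have "integrable M (\<lambda>x. 2 * (f x)\<^sup>2 + 2 * (h x)\<^sup>2)"
    using assms by (auto simp: L2_def)
  then have "integrable M (\<lambda>x. (f x + h x)\<^sup>2)"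
  proof (rule Bochner_Integration.integrable_bound)
    show "AE x in M. norm ((f x + h x)\<^sup>2) \<le> norm (2 * (f x)\<^sup>2 + 2 * (h x)\<^sup>2)"
      using square_add_le_weighted[of 1 1] by (auto simp: algebra_simps)
  qed measurable
  then show ?thesis by (simp add: L2_def)
qed

text \<open>Outside of \<open>L\<^sup>2\<close> the right-hand side is infinite. Inside, the weights of the convexity inequality
  are the two norms, up to an arbitrarily small shift.\<close>

lemma L2_norm_add_le:
  "L2_norm M (\<lambda>x. f x + h x) \<le> L2_norm M f + L2_norm M h"
proof (cases "f \<in> L2 M \<and> h \<in> L2 M")
  case False
  then show ?thesis by (auto simp: L2_norm_def)
next
  case True
  then have f: "f \<in> L2 M" and h: "h \<in> L2 M" by auto
  have int: "integrable M (\<lambda>x. (f x)\<^sup>2)" "integrable M (\<lambda>x. (h x)\<^sup>2)"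
      "integrable M (\<lambda>x. (f x + h x)\<^sup>2)"
    using f h L2_add[OF f h] by (auto simp: L2_def)
  define a where "a = sqrt (LINT x|M. (f x)\<^sup>2)"
  define b where "b = sqrt (LINT x|M. (h x)\<^sup>2)"
  have ab: "0 \<le> a" "0 \<le> b" "(LINT x|M. (f x)\<^sup>2) = a\<^sup>2" "(LINT x|M. (h x)\<^sup>2) = b\<^sup>2"
    by (simp_all add: a_def b_def)
  have "sqrt (LINT x|M. (f x + h x)\<^sup>2) \<le> a + b"
  proof (rule field_le_epsilon)
    fix e :: real assume e: "0 < e"
    \<comment> \<open>Shifting both norms keeps the weights positive when one of the functions vanishes.\<close>
    define a' b' where "a' = a + e / 2" and "b' = b + e / 2"
    have pos: "0 < a'" "0 < b'" "a \<le> a'" "b \<le> b'"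
      using ab e by (auto simp: a'_def b'_def)
    have "(LINT x|M. (f x + h x)\<^sup>2) \<le> (LINT x|M. (a' + b') * ((f x)\<^sup>2 / a' + (h x)\<^sup>2 / b'))"
      using int pos by (intro integral_mono square_add_le_weighted) auto
    also have "\<dots> = (a' + b') * (a\<^sup>2 / a' + b\<^sup>2 / b')"
      using int ab by simp
    also have "\<dots> \<le> (a' + b') * (a' + b')"
    proof (intro mult_left_mono add_mono)
      show "a\<^sup>2 / a' \<le> a'" "b\<^sup>2 / b' \<le> b'"
        using pos ab power_mono[of a a' 2] power_mono[of b b' 2]
        by (simp_all add: divide_le_eq power2_eq_square)
    qed (use pos in auto)
    finally have "(LINT x|M. (f x + h x)\<^sup>2) \<le> (a' + b')\<^sup>2"
      by (simp add: power2_eq_square)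
    then have "sqrt (LINT x|M. (f x + h x)\<^sup>2) \<le> a' + b'"
      using pos by (intro real_le_lsqrt) auto
    then show "sqrt (LINT x|M. (f x + h x)\<^sup>2) \<le> a + b + e"
      by (simp add: a'_def b'_def)
  qed
  then have "ennreal (sqrt (LINT x|M. (f x + h x)\<^sup>2)) \<le> ennreal a + ennreal b"
    using ab by (metis ennreal_leI ennreal_plus)
  then show ?thesis
    by (simp only: L2_norm_eq_ennreal[OF f] L2_norm_eq_ennreal[OF h]
        L2_norm_eq_ennreal[OF L2_add[OF f h]] a_def b_def)
qed

lemma L2_norm_sum_le:
  assumes "finite I"
  shows "L2_norm M (\<lambda>x. \<Sum>i\<in>I. f i x) \<le> (\<Sum>i\<in>I. L2_norm M (f i))"
  using assms
proof (induction I)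
  case empty
  then show ?case by (simp add: L2_norm_def L2_def)
next
  case (insert i I)
  then show ?case
    using order_trans[OF L2_norm_add_le[of M "f i" "\<lambda>x. \<Sum>i\<in>I. f i x"] add_left_mono]
    by simp
qed

text \<open>The total mass is one, so the square integral is at most the essential bound squared.\<close>

lemma (in prob_space) L2_norm_le_of_Linf_norm_le:
  assumes meas [measurable]: "z \<in> borel_measurable M" and k: "0 \<le> k"
    and le: "Linf_norm M z \<le> ennreal k"
  shows "L2_norm M z \<le> ennreal k"
proof -
  have "AE x in M. ennreal \<bar>z x\<bar> \<le> ennreal k"
    using esssup_AE[of "\<lambda>x. ennreal \<bar>z x\<bar>" M]
    by eventually_elim (use le in \<open>auto simp: Linf_norm_def\<close>)
  then have ae: "AE x in M. (z x)\<^sup>2 \<le> k\<^sup>2"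
    by eventually_elim (use k in \<open>auto simp: abs_le_square_iff[symmetric]\<close>)
  have int: "integrable M (\<lambda>x. (z x)\<^sup>2)"
    by (rule integrable_const_bound[where B = "k\<^sup>2"]) (use ae in auto)
  have "(LINT x|M. (z x)\<^sup>2) \<le> (LINT x|M. k\<^sup>2)"
    using int ae by (intro integral_mono_AE) auto
  then have "sqrt (LINT x|M. (z x)\<^sup>2) \<le> k"
    using k by (intro real_le_lsqrt) (auto simp: prob_space)
  with int show ?thesis
    by (auto simp: L2_norm_def L2_def intro: ennreal_leI)
qed

section \<open>Events of prescribed probability\<close>

lemma (in prob_space) with_probability_union_bound:
  assumes I: "finite I"
    and Q: "\<And>i. i \<in> I \<Longrightarrow> with_probability M (1 - p i) (Q i)"
    and p: "(\<Sum>i\<in>I. p i) \<le> q"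
  shows "with_probability M (1 - q) (\<lambda>\<omega>. \<forall>i\<in>I. Q i \<omega>)"
proof -
  obtain E where E: "E i \<in> events" "1 - p i \<le> prob (E i)" "\<forall>\<omega>\<in>E i. Q i \<omega>" if "i \<in> I" for i
    using Q unfolding with_probability_def by metis
  define F where "F = (\<Union>i\<in>I. space M - E i)"
  have F: "F \<in> events"
    unfolding F_def using E I by (intro sets.finite_UN) auto
  have "prob F \<le> (\<Sum>i\<in>I. prob (space M - E i))"
    unfolding F_def using E I by (intro finite_measure_subadditive_finite) auto
  also have "\<dots> \<le> (\<Sum>i\<in>I. p i)"
    using E by (intro sum_mono) (simp add: prob_compl algebra_simps)
  finally have "1 - q \<le> prob (space M - F)"
    using p F by (simp add: prob_compl)
  moreover have "Q i \<omega>" if "\<omega> \<in> space M - F" "i \<in> I" for i \<omega>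
    using that E by (auto simp: F_def)
  ultimately show ?thesis
    unfolding with_probability_def using F by (intro bexI[of _ "space M - F"]) auto
qed

lemma with_probability_mono:
  assumes "with_probability M q Q" "\<And>\<omega>. Q \<omega> \<Longrightarrow> R \<omega>"
  shows "with_probability M q R"
  using assms unfolding with_probability_def by blast

text \<open>A statement about abstract sample vectors holds with the same probability for concrete
  random variables, because independence says precisely that their joint law is the product measure.\<close>

lemma (in prob_space) with_probability_iid_samples:
  assumes iid: "iid_samples M \<nu> n Y" and n: "1 \<le> n"
    and Q: "with_probability (\<Pi>\<^sub>M i\<in>{..<n}. \<nu>) q Q"
  shows "with_probability M q (\<lambda>\<omega>. Q (restrict (\<lambda>i. Y i \<omega>) {..<n}))"
proof -
  let ?Z = "\<lambda>\<omega>. \<lambda>i\<in>{..<n}. Y i \<omega>" and ?N = "\<Pi>\<^sub>M i\<in>{..<n}. \<nu>"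
  have indep: "indep_vars (\<lambda>_. \<nu>) Y {..<n}" and dist: "\<And>i. i < n \<Longrightarrow> distr M \<nu> (Y i) = \<nu>"
    using iid by (auto simp: iid_samples_def)
  have Y [measurable]: "Y i \<in> measurable M \<nu>" if "i < n" for i
    using indep that by (auto simp: indep_vars_def)
  have Z: "?Z \<in> measurable M ?N"
    by (intro measurable_restrict) auto
  have "distr M ?N ?Z = (\<Pi>\<^sub>M i\<in>{..<n}. distr M \<nu> (Y i))"
    using indep n Y lessThan_empty_iff[of n] by (subst (asm) indep_vars_iff_distr_eq_PiM'[where M' = "\<lambda>_. \<nu>"]) auto
  also have "\<dots> = ?N"
    using dist by (intro PiM_cong) auto
  finally have Zdist: "distr M ?N ?Z = ?N" .
  obtain E where E: "E \<in> sets ?N" "q \<le> measure ?N E" "\<forall>ys\<in>E. Q ys"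
    using Q by (auto simp: with_probability_def)
  have "measure ?N E = measure (distr M ?N ?Z) E"
    by (simp only: Zdist)
  also have "\<dots> = prob (?Z -` E \<inter> space M)"
    by (rule measure_distr[OF Z E(1)])
  finally show ?thesis
    unfolding with_probability_def using E measurable_sets[OF Z E(1)]
    by (intro bexI[of _ "?Z -` E \<inter> space M"]) auto
qed

section \<open>The level updates\<close>

lemma sum_level_update:
  assumes "1 \<le> L"
  shows "(\<Sum>l=1..L. level_update gl l y) = gl L y"
  using assms
proof (induction L rule: dec_induct)
  case (step L)
  then show ?case by (simp add: level_update_def)
qed (simp add: level_update_def)

text \<open>The axioms of a quasi-norm speak of sums and multiples only; the next two facts transfer them
  to differences, where the updates and errors live.\<close>

lemma quasi_normed_subspace_diff:
  assumes "quasi_normed_subspace M S N" "u \<in> S" "v \<in> S"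
  shows "(\<lambda>x. u x - v x) \<in> S"
proof -
  have "(\<lambda>x. u x + (- 1) * v x) \<in> S"
    using assms unfolding quasi_normed_subspace_def by meson
  then show ?thesis by simp
qed

lemma quasi_norm_diff_le:
  assumes S: "quasi_normed_subspace M S N"
  obtains K where "1 \<le> K"
    "\<And>u v. u \<in> S \<Longrightarrow> v \<in> S \<Longrightarrow> N (\<lambda>x. u x - v x) \<le> K * (N u + N v)"
proof -
  obtain K where K: "1 \<le> K"
      "\<And>u v. u \<in> S \<Longrightarrow> v \<in> S \<Longrightarrow> N (\<lambda>x. u x + v x) \<le> K * (N u + N v)"
    using S unfolding quasi_normed_subspace_def by meson
  have neg: "(\<lambda>x. (- 1) * v x) \<in> S" "N (\<lambda>x. (- 1) * v x) = N v" if "v \<in> S" for v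
  proof -
    show "(\<lambda>x. (- 1) * v x) \<in> S"
      using S that unfolding quasi_normed_subspace_def by meson
    have "N (\<lambda>x. (- 1) * v x) = \<bar>- 1\<bar> * N v"
      using S that unfolding quasi_normed_subspace_def by meson
    then show "N (\<lambda>x. (- 1) * v x) = N v" by simp
  qed
  have "N (\<lambda>x. u x - v x) \<le> K * (N u + N v)" if "u \<in> S" "v \<in> S" for u v
    using K(2)[OF that(1) neg(1)[OF that(2)]] neg(2)[OF that(2)] by simp
  with K(1) show ?thesis by (rule that)
qed

lemma level_update_mem:
  assumes S: "quasi_normed_subspace M S N"
    and gl: "\<And>l. 1 \<le> l \<Longrightarrow> gl l \<in> S" and l: "1 \<le> l"
  shows "level_update gl l \<in> S"
proof (cases "l = 1")
  case True
  then show ?thesis using gl[of 1] by (simp add: level_update_def[abs_def])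
next
  case False
  then show ?thesis
    using quasi_normed_subspace_diff[OF S gl[OF l] gl[of "l - 1"]] l
    by (simp add: level_update_def[abs_def])
qed

text \<open>Both terms of an update approximate \<open>g\<close>, and the coarser one loses only a factor
  \<open>2 powr \<alpha>\<close>. The first update is \<open>gl 1\<close> itself, which is not small; its quasi-norm enters the constant
  through that of \<open>g\<close>.\<close>

lemma quasi_norm_level_update_le:
  fixes A \<alpha> :: real
  assumes S: "quasi_normed_subspace M S N" and g: "g \<in> S"
    and gl: "\<And>l. 1 \<le> l \<Longrightarrow> gl l \<in> S"
    and err: "\<And>l. 1 \<le> l \<Longrightarrow> N (\<lambda>y. g y - gl l y) \<le> A * 2 powr (- \<alpha> * real l)"
  obtains C where "0 < C" "\<And>l. 1 \<le> l \<Longrightarrow> N (level_update gl l) \<le> C * 2 powr (- \<alpha> * real l)"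
proof -
  obtain K where K: "1 \<le> K"
      "\<And>u v. u \<in> S \<Longrightarrow> v \<in> S \<Longrightarrow> N (\<lambda>x. u x - v x) \<le> K * (N u + N v)"
    using quasi_norm_diff_le[OF S] by blast
  have mem: "(\<lambda>y. g y - gl l y) \<in> S" if "1 \<le> l" for l
    using quasi_normed_subspace_diff[OF S g gl[OF that]] .
  define C1 where "C1 = K * (N g + A * 2 powr - \<alpha>) * 2 powr \<alpha>"
  define C2 where "C2 = K * (A * 2 powr \<alpha> + A)"
  define C where "C = max 1 (max C1 C2)"
  have "N (level_update gl l) \<le> C * 2 powr (- \<alpha> * real l)" if l: "1 \<le> l" for l
  proof (cases "l = 1")
    case True
    have "N (level_update gl l) = N (\<lambda>y. g y - (g y - gl 1 y))"
      using True by (simp add: level_update_def[abs_def])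
    also have "\<dots> \<le> K * (N g + N (\<lambda>y. g y - gl 1 y))"
      using K(2)[OF g mem[of 1]] by simp
    also have "\<dots> \<le> K * (N g + A * 2 powr - \<alpha>)"
      using err[of 1] K(1) by (intro mult_left_mono add_left_mono) auto
    also have "\<dots> = C1 * 2 powr (- \<alpha> * real l)"
      using True by (simp add: C1_def powr_minus)
    also have "\<dots> \<le> C * 2 powr (- \<alpha> * real l)"
      by (intro mult_right_mono) (auto simp: C_def)
    finally show ?thesis .
  next
    case False
    then have l1: "1 \<le> l - 1" using l by simp
    have "N (level_update gl l) = N (\<lambda>y. (g y - gl (l - 1) y) - (g y - gl l y))"
      using False by (simp add: level_update_def[abs_def])
    also have "\<dots> \<le> K * (N (\<lambda>y. g y - gl (l - 1) y) + N (\<lambda>y. g y - gl l y))"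
      by (rule K(2)[OF mem[OF l1] mem[OF l]])
    also have "\<dots> \<le> K * (A * 2 powr (- \<alpha> * real (l - 1)) + A * 2 powr (- \<alpha> * real l))"
      using err[OF l1] err[OF l] K(1) by (intro mult_left_mono add_mono) auto
    also have "2 powr (- \<alpha> * real (l - 1)) = 2 powr \<alpha> * 2 powr (- \<alpha> * real l)"
      using l by (simp add: powr_add[symmetric] of_nat_diff algebra_simps)
    also have "K * (A * (2 powr \<alpha> * 2 powr (- \<alpha> * real l)) + A * 2 powr (- \<alpha> * real l)) =
        C2 * 2 powr (- \<alpha> * real l)"
      by (simp add: C2_def algebra_simps)
    also have "\<dots> \<le> C * 2 powr (- \<alpha> * real l)"
      by (intro mult_right_mono) (auto simp: C_def)
    finally show ?thesis .
  qed
  moreover have "0 < C" by (simp add: C_def)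
  ultimately show ?thesis using that by blast
qed

section \<open>Failure probabilities and sample sizes\<close>

lemma level_\<gamma>_pos: "0 < level_\<gamma> \<alpha> L l"
  by (simp add: level_\<gamma>_def)

lemma level_p_bounds:
  assumes "0 < p" "p < 1" "l \<le> L"
  shows "0 < level_p p L l" "level_p p L l < 1"
proof -
  show "0 < level_p p L l" using assms by (simp add: level_p_def)
  have "2 powr (- (real L - real l)) \<le> 2 powr 0"
    using assms by (intro powr_mono) auto
  then have "level_p p L l \<le> p / 2 * 1"
    unfolding level_p_def using assms by (intro mult_left_mono) auto
  then show "level_p p L l < 1" using assms by simp
qed

text \<open>The terms are \<open>p / 2\<close>, \<open>p / 4\<close>, and so on, counted from the finest level.\<close>

lemma sum_level_p_le:
  assumes "0 < p"
  shows "(\<Sum>l=1..L. level_p p L l) \<le> p"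
proof -
  have "(\<Sum>l=1..L. level_p p L l) = p * (1 - (1/2) ^ L)"
  proof (induction L)
    case (Suc L)
    have "level_p p (Suc L) l = level_p p L l / 2" for l
    proof -
      have "2 powr (- (real (Suc L) - real l)) = 2 powr (- (real L - real l) - 1)"
        by (simp add: algebra_simps)
      then show ?thesis by (simp add: level_p_def powr_diff)
    qed
    then have "(\<Sum>l=1..L. level_p p (Suc L) l) = p * (1 - (1/2) ^ L) / 2"
      using Suc by (simp only: sum_divide_distrib[symmetric])
    moreover have "level_p p (Suc L) (Suc L) = p / 2"
      by (simp add: level_p_def)
    ultimately show ?case by (simp add: algebra_simps)
  qed simp
  also have "\<dots> \<le> p * 1"
    using assms by (intro mult_left_mono) auto
  finally show ?thesis by simp
qed

lemma ln_inverse_level_p: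
  assumes "0 < p"
  shows "ln (1 / level_p p L l) = ln (1 / p) + ln 2 * (1 + (real L - real l))"
  using assms by (simp add: level_p_def ln_mult ln_div ln_powr algebra_simps)

section \<open>The work overhead\<close>

text \<open>The linear factor comes from the growth of \<open>ln (1 / level_p p L l)\<close> on the coarse levels.\<close>

lemma summable_arith_geometric:
  fixes \<epsilon> :: real
  assumes "0 < \<epsilon>"
  shows "summable (\<lambda>k. (1 + real k) * 2 powr (- \<epsilon> * real k))"
proof -
  have "2 powr (- \<epsilon>) < 2 powr 0"
    using assms by (intro powr_less_mono) auto
  then have "summable (\<lambda>k. of_nat (Suc k) * (2 powr (- \<epsilon>)) ^ k :: real)"
    using geometric_deriv_sums[of "2 powr (- \<epsilon>)"] by (auto simp: sums_iff)
  moreover have "2 powr (- \<epsilon> * real k) = (2 powr (- \<epsilon>)) ^ k" for k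
    using powr_powr[of 2 "- \<epsilon>" "real k"] by (simp add: powr_realpow)
  ultimately show ?thesis by simp
qed

text \<open>The sample size is to be a multiple of \<open>ln (1 / p)\<close>, but it also contains the summands
  \<open>ln 2 * (1 + k)\<close>, from the level-wise failure probability, and \<open>1\<close>, from rounding up, neither of which
  vanishes as \<open>p\<close> tends to one. Keeping \<open>p \<le> q < 1\<close> bounds \<open>ln (1 / p)\<close> below by \<open>ln (1 / q)\<close>, so both
  can be absorbed at the price of a constant that depends on \<open>q\<close>.\<close>

lemma level_n_le:
  assumes n: "\<And>p \<gamma>. 0 < p \<Longrightarrow> p < 1 \<Longrightarrow> 0 < \<gamma> \<Longrightarrow>
      int (n p \<gamma>) \<le> \<lceil>real n\<^sub>0 * \<gamma> powr (- \<beta>) * ln (1 / p)\<rceil>"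
    and p: "0 < p" "p \<le> q" "q < 1" and ab: "0 \<le> \<alpha> * \<beta>" and l: "l \<le> L"
  shows "real (level_n n \<alpha> p L l) \<le>
    (real n\<^sub>0 * (1 + ln 2 / ln (1 / q)) + 1 / ln (1 / q)) * ln (1 / p) *
      ((1 + real (L - l)) * 2 powr (\<alpha> * \<beta> * real (L - l)))"
proof -
  define k where "k = real (L - l)"
  define G where "G = 2 powr (\<alpha> * \<beta> * k)"
  define s t where "s = ln (1 / p)" and "t = ln (1 / q)"
  have k: "0 \<le> k" "real L - real l = k"
    using l by (auto simp: k_def of_nat_diff)
  have t: "0 < t" using p by (simp add: t_def)
  have st: "t \<le> s" using p by (simp add: s_def t_def frac_le)
  then have ratio: "1 \<le> s / t" and s: "0 < s" using t by auto
  have G: "1 \<le> G"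
    using ab k by (auto simp: G_def intro!: ge_one_powr_ge_zero)
  have "real (level_n n \<alpha> p L l) \<le> real n\<^sub>0 * level_\<gamma> \<alpha> L l powr (- \<beta>) * ln (1 / level_p p L l) + 1"
    using n[OF level_p_bounds[of p l L] level_\<gamma>_pos[of \<alpha> L l]] p l
    unfolding level_n_def by linarith
  also have "level_\<gamma> \<alpha> L l powr (- \<beta>) = G"
    by (simp add: level_\<gamma>_def powr_powr k G_def algebra_simps)
  also have "ln (1 / level_p p L l) = s + ln 2 * (1 + k)"
    using ln_inverse_level_p[of p L l] p k by (simp add: s_def)
  also have "real n\<^sub>0 * G * (s + ln 2 * (1 + k)) + 1
      \<le> real n\<^sub>0 * G * (s * (1 + k) + ln 2 * (1 + k) * (s / t)) + (s / t) * (1 + k) * G"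
  proof (intro add_mono mult_left_mono)
    show "s \<le> s * (1 + k)" using s k by (simp add: algebra_simps)
    have "ln 2 * (1 + k) * 1 \<le> ln 2 * (1 + k) * (s / t)"
      using ratio k by (intro mult_left_mono) auto
    then show "ln 2 * (1 + k) \<le> ln 2 * (1 + k) * (s / t)" by simp
    have "1 * 1 * 1 \<le> (s / t) * (1 + k) * G"
      using ratio k(1) G s t by (intro mult_mono mult_nonneg_nonneg) auto
    then show "1 \<le> (s / t) * (1 + k) * G" by simp
  qed (use G k s t in auto)
  also have "\<dots> = (real n\<^sub>0 * (1 + ln 2 / t) + 1 / t) * s * ((1 + k) * G)"
    using t by (simp add: field_simps)
  finally show ?thesis
    by (simp add: k_def G_def s_def t_def)
qed

lemma work_overhead_le:
  fixes \<tau> :: "nat \<Rightarrow> real"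
  assumes n: "\<And>p \<gamma>. 0 < p \<Longrightarrow> p < 1 \<Longrightarrow> 0 < \<gamma> \<Longrightarrow>
      int (n p \<gamma>) \<le> \<lceil>real n\<^sub>0 * \<gamma> powr (- \<beta>) * ln (1 / p)\<rceil>"
    and ab: "0 \<le> \<alpha> * \<beta>" "\<alpha> * \<beta> < \<delta>" and q: "0 < q" "q < 1"
    and c: "0 < c" "0 < c'"
      "\<And>l. 1 \<le> l \<Longrightarrow> c * 2 powr (\<delta> * real l) \<le> \<tau> l \<and> \<tau> l \<le> c' * 2 powr (\<delta> * real l)"
  shows "\<exists>K>0. \<forall>p\<in>{0<..q}. \<forall>L\<ge>1. work_overhead n \<alpha> \<tau> p L \<le> K * ln (1 / p)"
proof -
  define \<epsilon> where "\<epsilon> = \<delta> - \<alpha> * \<beta>"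
  define F where "F k = (1 + real k) * 2 powr (- \<epsilon> * real k)" for k
  have F: "summable F" "\<And>k. 0 < F k"
    using summable_arith_geometric[of \<epsilon>] ab by (auto simp: F_def[abs_def] \<epsilon>_def)
  define T where "T = suminf F"
  have T: "0 < T" unfolding T_def by (rule suminf_pos[OF F])
  define H where "H = real n\<^sub>0 * (1 + ln 2 / ln (1 / q)) + 1 / ln (1 / q)"
  have H: "0 < H" unfolding H_def
    using q by (intro add_nonneg_pos mult_nonneg_nonneg add_nonneg_nonneg) auto
  define K where "K = c' / c * H * T"
  have "work_overhead n \<alpha> \<tau> p L \<le> K * ln (1 / p)" if p: "0 < p" "p \<le> q" and L: "1 \<le> L" for p L
  proof -
    have \<tau>L: "0 < \<tau> L" "c * 2 powr (\<delta> * real L) \<le> \<tau> L"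
    proof -
      have "0 < c * 2 powr (\<delta> * real L)" using c(1) by simp
      also show "c * 2 powr (\<delta> * real L) \<le> \<tau> L" using c(3)[OF L] by simp
      finally show "0 < \<tau> L" .
    qed
    have lnp: "0 \<le> ln (1 / p)" using p q by simp
    have term_le: "real (level_n n \<alpha> p L l) * (\<tau> l / \<tau> L) \<le> c' / c * H * ln (1 / p) * F (L - l)"
      if l: "l \<in> {1..L}" for l
    proof -
      have "\<tau> l / \<tau> L \<le> (c' * 2 powr (\<delta> * real l)) / (c * 2 powr (\<delta> * real L))"
        using c(3)[of l] l \<tau>L c by (intro frac_le) auto
      also have "2 powr (\<delta> * real l) = 2 powr (\<delta> * real L) * 2 powr (- \<delta> * real (L - l))"
        using l by (simp only: powr_add[symmetric]) (simp add: of_nat_diff algebra_simps)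
      also have "(c' * (2 powr (\<delta> * real L) * 2 powr (- \<delta> * real (L - l)))) / (c * 2 powr (\<delta> * real L)) =
          c' / c * 2 powr (- \<delta> * real (L - l))"
        by simp
      finally have ratio: "\<tau> l / \<tau> L \<le> c' / c * 2 powr (- \<delta> * real (L - l))" .
      have "real (level_n n \<alpha> p L l) * (\<tau> l / \<tau> L) \<le>
          (H * ln (1 / p) * ((1 + real (L - l)) * 2 powr (\<alpha> * \<beta> * real (L - l)))) *
          (c' / c * 2 powr (- \<delta> * real (L - l)))"
      proof (rule mult_mono[OF _ ratio])
        show "real (level_n n \<alpha> p L l) \<le> H * ln (1 / p) * ((1 + real (L - l)) * 2 powr (\<alpha> * \<beta> * real (L - l)))"
          unfolding H_def using l by (intro level_n_le[OF n p(1,2) q(2) ab(1)]) auto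
        have "0 \<le> c * 2 powr (\<delta> * real l)" using c(1) by simp
        also have "\<dots> \<le> \<tau> l" using c(3)[of l] l by simp
        finally show "0 \<le> \<tau> l / \<tau> L" using \<tau>L(1) by simp
      qed (use H lnp in auto)
      also have "\<dots> = c' / c * H * ln (1 / p) *
          ((1 + real (L - l)) * (2 powr (\<alpha> * \<beta> * real (L - l)) * 2 powr (- \<delta> * real (L - l))))"
        by simp
      also have "2 powr (\<alpha> * \<beta> * real (L - l)) * 2 powr (- \<delta> * real (L - l)) = 2 powr (- \<epsilon> * real (L - l))"
        by (simp add: powr_add[symmetric] \<epsilon>_def algebra_simps)
      finally show ?thesis by (simp add: F_def)
    qed
    have "work_overhead n \<alpha> \<tau> p L = (\<Sum>l=1..L. real (level_n n \<alpha> p L l) * (\<tau> l / \<tau> L))"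
      by (simp add: work_overhead_def multilevel_work_def sum_divide_distrib)
    also have "\<dots> \<le> (\<Sum>l=1..L. c' / c * H * ln (1 / p) * F (L - l))"
      by (intro sum_mono term_le)
    also have "\<dots> = c' / c * H * ln (1 / p) * (\<Sum>l=1..L. F (L - l))"
      by (simp add: sum_distrib_left)
    also have "(\<Sum>l=1..L. F (L - l)) = (\<Sum>k<L. F k)"
      by (rule sum.reindex_bij_witness[of _ "\<lambda>k. L - k" "\<lambda>l. L - l"]) auto
    also have "c' / c * H * ln (1 / p) * (\<Sum>k<L. F k) \<le> c' / c * H * ln (1 / p) * T"
      unfolding T_def using F c H lnp
      by (intro mult_left_mono sum_le_suminf mult_nonneg_nonneg) (auto simp: less_imp_le)
    finally show ?thesis by (simp add: K_def mult_ac)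
  qed
  moreover have "0 < K" using c H T by (simp add: K_def)
  ultimately show ?thesis by auto
qed

theorem theorem2:
  fixes D :: "(real ^ 'd) set"
    and a\<^sub>0 :: "real ^ 'd \<Rightarrow> real" and a :: "'m::finite \<Rightarrow> real ^ 'd \<Rightarrow> real" and r R :: real
    and f G :: "(real ^ 'd \<Rightarrow> real) \<Rightarrow> real"
    and V :: "nat \<Rightarrow> (real ^ 'd \<Rightarrow> real) set"
    and u :: "real ^ 'm \<Rightarrow> real ^ 'd \<Rightarrow> real"
    and ul :: "nat \<Rightarrow> real ^ 'm \<Rightarrow> real ^ 'd \<Rightarrow> real"
    and g :: "real ^ 'm \<Rightarrow> real" and gl :: "nat \<Rightarrow> real ^ 'm \<Rightarrow> real"
    and \<mu> :: "(real ^ 'm) measure"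
    and S :: "(real ^ 'm \<Rightarrow> real) set" and norm\<^sub>S :: "(real ^ 'm \<Rightarrow> real) \<Rightarrow> real"
    and \<M> :: "real \<Rightarrow> (real ^ 'm \<Rightarrow> real) set"
    and w :: "real ^ 'm \<Rightarrow> real"
    and P :: "real \<Rightarrow> nat \<Rightarrow> (nat \<Rightarrow> real ^ 'm) \<Rightarrow> (real ^ 'm \<Rightarrow> real) \<Rightarrow> (real ^ 'm \<Rightarrow> real)"
    and A \<alpha> C B \<beta> \<delta> :: real and n\<^sub>0 :: nat and n :: "real \<Rightarrow> real \<Rightarrow> nat"
    and cost :: "nat \<Rightarrow> real ^ 'm \<Rightarrow> real" and \<tau> :: "nat \<Rightarrow> real"
  assumes domain: "bounded_Lipschitz_domain D"
    and coeff_measurable: "a\<^sub>0 \<in> borel_measurable (lebesgue_on D)"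
      "\<And>m. a m \<in> borel_measurable (lebesgue_on D)"
    and elliptic: "0 < r"
      "\<And>x y. x \<in> D \<Longrightarrow> y \<in> param_box \<Longrightarrow>
         r \<le> affine_coeff a\<^sub>0 a x y \<and> affine_coeff a\<^sub>0 a x y \<le> R"
    and functionals: "f \<in> dual_H10 D" "G \<in> dual_H10 D"
    and galerkin: "galerkin_spaces D V"
    and solution: "\<And>y. y \<in> param_box \<Longrightarrow>
        variational_solution D (H10 D) (\<lambda>x. affine_coeff a\<^sub>0 a x y) f (u y)"
    and galerkin_solution: "\<And>l y. y \<in> param_box \<Longrightarrow>
        variational_solution D (V l) (\<lambda>x. affine_coeff a\<^sub>0 a x y) f (ul l y)"
    and quantity_of_interest: "\<And>y. y \<in> param_box \<Longrightarrow> g y = G (u y)"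
      "\<And>l y. y \<in> param_box \<Longrightarrow> gl l y = G (ul l y)"
    and measure: "prob_space \<mu>" "sets \<mu> = sets (restrict_space borel param_box)"
    and space_S: "quasi_normed_subspace \<mu> S norm\<^sub>S" "continuously_embedded \<mu> S norm\<^sub>S"
    and in_S: "g \<in> S" "\<And>l. 1 \<le> l \<Longrightarrow> gl l \<in> S"
    and model_classes: "\<And>\<gamma>. 0 < \<gamma> \<Longrightarrow> \<M> \<gamma> \<subseteq> borel_measurable \<mu>"
    and weight: "w \<in> borel_measurable \<mu>" "\<And>y. y \<in> param_box \<Longrightarrow> 0 \<le> w y"
      "(\<integral>\<^sup>+ y. inverse (ennreal (w y)) \<partial>\<mu>) = 1"
    and projection: "least_squares_approximation \<mu> w \<M> P"
    and A1: "0 < A" "0 < \<alpha>"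
      "\<And>l. 1 \<le> l \<Longrightarrow> norm\<^sub>S (\<lambda>y. g y - gl l y) \<le> A * 2 powr (- \<alpha> * real l)"
    and A2: "0 < C"
      "\<And>\<gamma> z. 0 < \<gamma> \<Longrightarrow> z \<in> S \<Longrightarrow>
         (INF v\<in>\<M> \<gamma>. Linf_norm \<mu> (\<lambda>y. z y - v y)) \<le> ennreal (C * \<gamma> * norm\<^sub>S z)"
    and A3: "0 < B" "0 < \<beta>"
      "\<And>p \<gamma>. 0 < p \<Longrightarrow> p < 1 \<Longrightarrow> 0 < \<gamma> \<Longrightarrow>
         1 \<le> n p \<gamma> \<and> int (n p \<gamma>) \<le> \<lceil>real n\<^sub>0 * \<gamma> powr (- \<beta>) * ln (1 / p)\<rceil>"
      "\<And>p \<gamma> z. 0 < p \<Longrightarrow> p < 1 \<Longrightarrow> 0 < \<gamma> \<Longrightarrow> z \<in> Linf \<mu> \<Longrightarrow>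
         with_probability (\<Pi>\<^sub>M i\<in>{..<n p \<gamma>}. sampling_measure \<mu> w) (1 - p)
           (\<lambda>ys. L2_norm \<mu> (\<lambda>y. z y - P \<gamma> (n p \<gamma>) ys z y)
                  \<le> ennreal B * (INF v\<in>\<M> \<gamma>. Linf_norm \<mu> (\<lambda>y. z y - v y)))"
    and A4: "\<alpha> * \<beta> < \<delta>"
      "\<And>l y. 1 \<le> l \<Longrightarrow> y \<in> param_box \<Longrightarrow> cost l y = \<tau> l"
      "\<exists>c>0. \<exists>c'>0. \<forall>l\<ge>1. c * 2 powr (\<delta> * real l) \<le> \<tau> l \<and> \<tau> l \<le> c' * 2 powr (\<delta> * real l)"
  shows "(\<exists>c>0. \<forall>p\<in>{0<..<1}. \<forall>L\<ge>1. \<forall>(\<Omega> :: 'w measure) Y.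
            prob_space \<Omega> \<longrightarrow>
            (\<forall>l\<in>{1..L}. iid_samples \<Omega> (sampling_measure \<mu> w) (level_n n \<alpha> p L l) (Y l)) \<longrightarrow>
            with_probability \<Omega> (1 - p)
              (\<lambda>\<omega>. L2_norm \<mu> (\<lambda>y. g y - multilevel_approximation P n \<alpha> gl p L (\<lambda>l i. Y l i \<omega>) y)
                     \<le> ennreal (c * (2 powr (- \<alpha> * real L) * real L))))
       \<and> (\<forall>q\<in>{0<..<1}. \<exists>c>0. \<forall>p\<in>{0<..q}. \<forall>L\<ge>1.
            work_overhead n \<alpha> \<tau> p L \<le> c * ln (1 / p))"
proof (rule conjI)
  interpret prob_space \<mu> by (rule measure(1))
  obtain C\<^sub>1 where C\<^sub>1: "0 < C\<^sub>1"
      "\<And>l. 1 \<le> l \<Longrightarrow> norm\<^sub>S (level_update gl l) \<le> C\<^sub>1 * 2 powr (- \<alpha> * real l)"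
    using quasi_norm_level_update_le[OF space_S(1) in_S A1(3)] by blast
  obtain K\<^sub>0 where K\<^sub>0: "\<And>z. z \<in> S \<Longrightarrow> Linf_norm \<mu> z \<le> ennreal (K\<^sub>0 * norm\<^sub>S z)"
    using space_S(2) by (auto simp: continuously_embedded_def)
  define K where "K = max 0 K\<^sub>0"
  have S_Linf: "S \<subseteq> Linf \<mu>" and norm_nonneg: "\<And>z. z \<in> S \<Longrightarrow> 0 \<le> norm\<^sub>S z"
    using space_S(1) by (auto simp: quasi_normed_subspace_def)
  \<comment> \<open>The first summand bounds the discretisation error, the second one projection error.\<close>
  define c where "c = K * A + B * C * C\<^sub>1"
  have c: "0 < c" using A1 A2(1) A3(1) C\<^sub>1(1) by (auto simp: c_def K_def intro!: add_nonneg_pos)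
  have discretisation: "L2_norm \<mu> (\<lambda>y. g y - gl L y) \<le> ennreal (K * A * 2 powr (- \<alpha> * real L))"
    if L: "1 \<le> L" for L
  proof -
    have z: "(\<lambda>y. g y - gl L y) \<in> S"
      using quasi_normed_subspace_diff[OF space_S(1) in_S(1) in_S(2)[OF L]] .
    have "K\<^sub>0 * norm\<^sub>S (\<lambda>y. g y - gl L y) \<le> K * (A * 2 powr (- \<alpha> * real L))"
      using A1(3)[OF L] norm_nonneg[OF z] by (intro mult_mono) (auto simp: K_def)
    then have "Linf_norm \<mu> (\<lambda>y. g y - gl L y) \<le> ennreal (K * A * 2 powr (- \<alpha> * real L))"
      using order_trans[OF K\<^sub>0[OF z] ennreal_leI] by (simp only: mult.assoc)
    with z S_Linf A1(1) show ?thesis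
      by (intro L2_norm_le_of_Linf_norm_le) (auto simp: Linf_def K_def)
  qed
  have level_error: "ennreal B * (INF v\<in>\<M> (level_\<gamma> \<alpha> L l). Linf_norm \<mu> (\<lambda>y. level_update gl l y - v y))
      \<le> ennreal (B * C * C\<^sub>1 * 2 powr (- \<alpha> * real L))" if l: "1 \<le> l" for l L
  proof -
    let ?z = "level_update gl l" and ?\<gamma> = "level_\<gamma> \<alpha> L l"
    have z: "?z \<in> S" using level_update_mem[OF space_S(1) in_S(2) l] .
    have "(INF v\<in>\<M> ?\<gamma>. Linf_norm \<mu> (\<lambda>y. ?z y - v y)) \<le> ennreal (C * ?\<gamma> * norm\<^sub>S ?z)"
      by (rule A2(2)[OF level_\<gamma>_pos z])
    also have "\<dots> \<le> ennreal (C * ?\<gamma> * (C\<^sub>1 * 2 powr (- \<alpha> * real l)))"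
      using C\<^sub>1(2)[OF l] A2(1) level_\<gamma>_pos[of \<alpha> L l]
      by (intro ennreal_leI mult_left_mono) auto
    \<comment> \<open>The exponents \<open>- \<alpha> * (L - l)\<close> and \<open>- \<alpha> * l\<close> add up to the same value on every level.\<close>
    also have "C * ?\<gamma> * (C\<^sub>1 * 2 powr (- \<alpha> * real l)) = C * C\<^sub>1 * 2 powr (- \<alpha> * real L)"
      by (simp add: level_\<gamma>_def powr_add[symmetric] algebra_simps)
    finally have "ennreal B * (INF v\<in>\<M> ?\<gamma>. Linf_norm \<mu> (\<lambda>y. ?z y - v y))
        \<le> ennreal B * ennreal (C * C\<^sub>1 * 2 powr (- \<alpha> * real L))"
      by (intro mult_left_mono) auto
    then show ?thesis
      using A3(1) by (simp add: ennreal_mult'[symmetric] mult.assoc)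
  qed
  have "with_probability \<Omega> (1 - p)
      (\<lambda>\<omega>. L2_norm \<mu> (\<lambda>y. g y - multilevel_approximation P n \<alpha> gl p L (\<lambda>l i. Y l i \<omega>) y)
             \<le> ennreal (c * (2 powr (- \<alpha> * real L) * real L)))"
    if p: "0 < p" "p < 1" and L: "1 \<le> L" and \<Omega>: "prob_space \<Omega>"
      and iid: "\<forall>l\<in>{1..L}. iid_samples \<Omega> (sampling_measure \<mu> w) (level_n n \<alpha> p L l) (Y l)"
    for p L and \<Omega> :: "'w measure" and Y
  proof -
    interpret \<Omega>: prob_space \<Omega> by (rule \<Omega>)
    let ?e = "2 powr (- \<alpha> * real L)"
    define R where "R l \<omega> y = level_update gl l y - P (level_\<gamma> \<alpha> L l) (level_n n \<alpha> p L l)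
      (restrict (\<lambda>i. Y l i \<omega>) {..<level_n n \<alpha> p L l}) (level_update gl l) y" for l \<omega> y
    have "with_probability \<Omega> (1 - level_p p L l) (\<lambda>\<omega>. L2_norm \<mu> (R l \<omega>) \<le> ennreal (B * C * C\<^sub>1 * ?e))"
      if l: "l \<in> {1..L}" for l
    proof -
      have l': "1 \<le> l" "l \<le> L" using l by auto
      have z: "level_update gl l \<in> Linf \<mu>"
        using level_update_mem[OF space_S(1) in_S(2) l'(1)] S_Linf by auto
      note pl = level_p_bounds[OF p l'(2)]
      have "1 \<le> level_n n \<alpha> p L l"
        using A3(3)[OF pl level_\<gamma>_pos[of \<alpha> L l]] by (simp add: level_n_def)
      from \<Omega>.with_probability_iid_samples[OF iid[rule_format, OF l] this
          A3(4)[OF pl level_\<gamma>_pos z, of \<alpha> L l, folded level_n_def]]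
      show ?thesis
        unfolding R_def[abs_def]
        by (rule with_probability_mono) (rule order_trans[OF _ level_error[OF l'(1)]])
    qed
    then have "with_probability \<Omega> (1 - p)
        (\<lambda>\<omega>. \<forall>l\<in>{1..L}. L2_norm \<mu> (R l \<omega>) \<le> ennreal (B * C * C\<^sub>1 * ?e))"
      using sum_level_p_le[OF p(1), of L] by (intro \<Omega>.with_probability_union_bound) auto
    then show ?thesis
    proof (rule with_probability_mono)
      fix \<omega> assume good: "\<forall>l\<in>{1..L}. L2_norm \<mu> (R l \<omega>) \<le> ennreal (B * C * C\<^sub>1 * ?e)"
      have "g y - multilevel_approximation P n \<alpha> gl p L (\<lambda>l i. Y l i \<omega>) y =
          (g y - gl L y) + (\<Sum>l=1..L. R l \<omega> y)" for y
        using sum_level_update[OF L, of gl y]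
        by (simp add: multilevel_approximation_def R_def sum_subtractf)
      then have "L2_norm \<mu> (\<lambda>y. g y - multilevel_approximation P n \<alpha> gl p L (\<lambda>l i. Y l i \<omega>) y) =
          L2_norm \<mu> (\<lambda>y. (g y - gl L y) + (\<Sum>l=1..L. R l \<omega> y))"
        by (simp only:)
      also have "\<dots> \<le> L2_norm \<mu> (\<lambda>y. g y - gl L y) + (\<Sum>l=1..L. L2_norm \<mu> (R l \<omega>))"
        by (rule order_trans[OF L2_norm_add_le add_left_mono[OF L2_norm_sum_le]]) simp
      also have "\<dots> \<le> ennreal (K * A * ?e) + (\<Sum>l=1..L. ennreal (B * C * C\<^sub>1 * ?e))"
        using good by (intro add_mono discretisation[OF L] sum_mono) auto
      also have "\<dots> = ennreal (K * A * ?e + real L * (B * C * C\<^sub>1 * ?e))"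
        using A1(1) A2(1) A3(1) C\<^sub>1(1)
        by (simp add: K_def ennreal_of_nat_eq_real_of_nat ennreal_mult')
      also have "\<dots> \<le> ennreal (c * (?e * real L))"
      proof (rule ennreal_leI)
        \<comment> \<open>The single discretisation error is absorbed into the \<open>L\<close> projection errors.\<close>
        have "K * A * ?e * 1 \<le> K * A * ?e * real L"
          using A1(1) L by (intro mult_left_mono) (auto simp: K_def)
        then show "K * A * ?e + real L * (B * C * C\<^sub>1 * ?e) \<le> c * (?e * real L)"
          by (simp add: c_def algebra_simps)
      qed
      finally show "L2_norm \<mu> (\<lambda>y. g y - multilevel_approximation P n \<alpha> gl p L (\<lambda>l i. Y l i \<omega>) y)
          \<le> ennreal (c * (?e * real L))" .
    qed
  qed
  with c show "\<exists>c>0. \<forall>p\<in>{0<..<1}. \<forall>L\<ge>1. \<forall>(\<Omega> :: 'w measure) Y.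
      prob_space \<Omega> \<longrightarrow>
      (\<forall>l\<in>{1..L}. iid_samples \<Omega> (sampling_measure \<mu> w) (level_n n \<alpha> p L l) (Y l)) \<longrightarrow>
      with_probability \<Omega> (1 - p)
        (\<lambda>\<omega>. L2_norm \<mu> (\<lambda>y. g y - multilevel_approximation P n \<alpha> gl p L (\<lambda>l i. Y l i \<omega>) y)
               \<le> ennreal (c * (2 powr (- \<alpha> * real L) * real L)))"
    by (intro exI[of _ c] conjI ballI allI impI) auto
next
  obtain c c' where "0 < c" "0 < c'"
      "\<And>l. 1 \<le> l \<Longrightarrow> c * 2 powr (\<delta> * real l) \<le> \<tau> l \<and> \<tau> l \<le> c' * 2 powr (\<delta> * real l)"
    using A4(3) by blast
  moreover have "0 \<le> \<alpha> * \<beta>" using A1(2) A3(2) by simp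
  ultimately show "\<forall>q\<in>{0<..<1}. \<exists>c>0. \<forall>p\<in>{0<..q}. \<forall>L\<ge>1.
      work_overhead n \<alpha> \<tau> p L \<le> c * ln (1 / p)"
    using A3(3) A4(1) by (intro ballI work_overhead_le[of n n\<^sub>0 \<beta> \<alpha> \<delta> _ c c' \<tau>]) simp_all
qed

end
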